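(* Let $n\ge1$. As a Poisson algebra, the ring $\mathbb{Q}[z_1,\dots,z_n,\overline z_1,\dots,\overline z_n]^{S_n}$ of bisymmetric functions is generated by the power sum functions $\tau_1,\dots,\tau_n,\overline\tau_1,\dots,\overline\tau_n$; that is, the ring of bisymmetric functions is generated by $\tau_1,\dots,\tau_n,\overline\tau_1,\dots,\overline\tau_n$ together with iterated Poisson brackets in these functions. Consequently, the ring of bisymmetric functions is generated as well by the elementary symmetric functions $\sigma_1,\dots,\sigma_n,\overline\sigma_1,\dots,\overline\sigma_n$ together with iterated Poisson brackets in these functions.
   Context: $S_n$ permutes the variables $z_1,\dots,z_n$ and the variables $\overline z_1,\dots,\overline z_n$ simultaneously (diagonal action). $\tau_k=z_1^k+\dots+z_n^k$ and $\overline\tau_k=\overline z_1^{\,k}+\dots+\overline z_n^{\,k}$; $\sigma_k$ and $\overline\sigma_k$ are the $k$-th elementary symmetric functions in $z_1,\dots,z_n$ and in $\overline z_1,\dots,\overline z_n$, respectively. The Poisson bracket (coming from the Kähler potential $\sum_j\log^2|z_j|$ on the diagonal torus $(\mathbb{C}^* )^n$ of $\mathrm{GL}(n,\mathbb{C})$) is determined by $\frac{i}{2}\{z_j,\overline z_k\}=\delta_{jk}z_j\overline z_j$, $\{z_j,z_k\}=0=\{\overline z_j,\overline z_k\}$, bilinearity and the derivation property. Over $\mathbb{Q}$ one uses the rescaled bracket $\frac{i}{2}\{\cdot,\cdot\}$, which preserves rational coefficients and $S_n$-invariance. *)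

theory Defs
  imports Complex_Main "HOL-Library.Poly_Mapping" "HOL-Library.Cardinality"
begin

(* Polynomials over Q in z_j and conj(z_j), where j ranges over a finite type 'n, so n = CARD('n) >= 1.
   The two families are algebraically independent indeterminates. *)
datatype 'n zvar = Hol 'n | Anti 'n

type_synonym 'n zpoly = "('n zvar \<Rightarrow>\<^sub>0 nat) \<Rightarrow>\<^sub>0 rat"

definition cst :: "rat \<Rightarrow> 'n zpoly" where
  "cst c = Poly_Mapping.single 0 c"

definition indet :: "'n zvar \<Rightarrow> 'n zpoly" where
  "indet v = Poly_Mapping.single (Poly_Mapping.single v 1) 1"

abbreviation zz :: "'n \<Rightarrow> 'n zpoly" where
  "zz j \<equiv> indet (Hol j)"

abbreviation zbar :: "'n \<Rightarrow> 'n zpoly" where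
  "zbar j \<equiv> indet (Anti j)"

definition poly_subst :: "('n zvar \<Rightarrow> 'n zpoly) \<Rightarrow> 'n zpoly \<Rightarrow> 'n zpoly" where
  "poly_subst s f = (\<Sum>m\<in>Poly_Mapping.keys f.
     cst (Poly_Mapping.lookup f m) * (\<Prod>v\<in>Poly_Mapping.keys m. s v ^ Poly_Mapping.lookup m v))"

definition perm_act :: "('n \<Rightarrow> 'n) \<Rightarrow> 'n zpoly \<Rightarrow> 'n zpoly" where
  "perm_act p = poly_subst (\<lambda>v. case v of Hol j \<Rightarrow> zz (p j) | Anti j \<Rightarrow> zbar (p j))"

definition bisymmetric :: "'n zpoly set" where
  "bisymmetric = {f. \<forall>p. bij p \<longrightarrow> perm_act p f = f}"

definition power_sum :: "nat \<Rightarrow> 'n::finite zpoly" where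
  "power_sum k = (\<Sum>j\<in>UNIV. zz j ^ k)"

definition power_sum_bar :: "nat \<Rightarrow> 'n::finite zpoly" where
  "power_sum_bar k = (\<Sum>j\<in>UNIV. zbar j ^ k)"

definition elem_sym :: "nat \<Rightarrow> 'n::finite zpoly" where
  "elem_sym k = (\<Sum>A | card A = k. \<Prod>j\<in>A. zz j)"

definition elem_sym_bar :: "nat \<Rightarrow> 'n::finite zpoly" where
  "elem_sym_bar k = (\<Sum>A | card A = k. \<Prod>j\<in>A. zbar j)"

(* B is the bracket (i/2){_,_}; the factor i/2 is what keeps the coefficients rational.
   Linearity and the Leibniz rule in the second argument follow from antisymmetry. *)
definition is_torus_bracket :: "('n zpoly \<Rightarrow> 'n zpoly \<Rightarrow> 'n zpoly) \<Rightarrow> bool" where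
  "is_torus_bracket B \<longleftrightarrow>
     (\<forall>f g. B f g = - B g f) \<and>
     (\<forall>f g h. B (f + g) h = B f h + B g h) \<and>
     (\<forall>c f h. B (cst c * f) h = cst c * B f h) \<and>
     (\<forall>f g h. B (f * g) h = f * B g h + B f h * g) \<and>
     (\<forall>j k. B (zz j) (zbar k) = (if j = k then zz j * zbar j else 0)) \<and>
     (\<forall>j k. B (zz j) (zz k) = 0) \<and>
     (\<forall>j k. B (zbar j) (zbar k) = 0)"

(* Well defined by ex1_torus_bracket below. *)
definition poisson :: "'n zpoly \<Rightarrow> 'n zpoly \<Rightarrow> 'n zpoly" where
  "poisson = (THE B. is_torus_bracket B)"

(* Unital subalgebras over Q: the constants belong to them, and closure under scalars
   and subtraction follows from closure under multiplication by constants. *)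
inductive_set alg_generated :: "'n zpoly set \<Rightarrow> 'n zpoly set" for G where
  gen: "f \<in> G \<Longrightarrow> f \<in> alg_generated G"
| const: "cst c \<in> alg_generated G"
| add: "f \<in> alg_generated G \<Longrightarrow> g \<in> alg_generated G \<Longrightarrow> f + g \<in> alg_generated G"
| mult: "f \<in> alg_generated G \<Longrightarrow> g \<in> alg_generated G \<Longrightarrow> f * g \<in> alg_generated G"

inductive_set poisson_generated :: "'n zpoly set \<Rightarrow> 'n zpoly set" for G where
  gen: "f \<in> G \<Longrightarrow> f \<in> poisson_generated G"
| const: "cst c \<in> poisson_generated G"
| add: "f \<in> poisson_generated G \<Longrightarrow> g \<in> poisson_generated G \<Longrightarrow> f + g \<in> poisson_generated G"
| mult: "f \<in> poisson_generated G \<Longrightarrow> g \<in> poisson_generated G \<Longrightarrow> f * g \<in> poisson_generated G"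
| bracket: "f \<in> poisson_generated G \<Longrightarrow> g \<in> poisson_generated G \<Longrightarrow> poisson f g \<in> poisson_generated G"

inductive_set iterated_brackets :: "'n zpoly set \<Rightarrow> 'n zpoly set" for G where
  gen: "f \<in> G \<Longrightarrow> f \<in> iterated_brackets G"
| bracket: "f \<in> iterated_brackets G \<Longrightarrow> g \<in> iterated_brackets G \<Longrightarrow> poisson f g \<in> iterated_brackets G"


subsection \<open>Existence and uniqueness of the bracket, and the Jacobi identity\<close>

lemma cst_simps:
  "cst 0 = 0" "cst 1 = 1" "cst (a + b) = cst a + cst b" "cst (a * b) = cst a * cst b"
  by (simp_all add: cst_def single_add mult_single)

lemma single_sum_expand:
  fixes f :: "'a \<Rightarrow>\<^sub>0 'b::comm_monoid_add"
  shows "(\<Sum>m\<in>Poly_Mapping.keys f. Poly_Mapping.single m (Poly_Mapping.lookup f m)) = f"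
proof (rule poly_mapping_eqI)
  fix k
  show "Poly_Mapping.lookup (\<Sum>m\<in>Poly_Mapping.keys f. Poly_Mapping.single m (Poly_Mapping.lookup f m)) k = Poly_Mapping.lookup f k"
    by (cases "k \<in> Poly_Mapping.keys f")
       (auto simp: lookup_sum lookup_single when_def in_keys_iff sum.delta)
qed

lemma indet_power: "indet v ^ k = Poly_Mapping.single (Poly_Mapping.single v k) 1"
  by (induction k) (simp_all add: indet_def mult_single single_add[symmetric])

lemma single_prod:
  "finite A \<Longrightarrow> (\<Prod>v\<in>A. Poly_Mapping.single (g v) (1::rat)) = Poly_Mapping.single (\<Sum>v\<in>A. g v) 1"
  by (induction rule: finite_induct) (simp_all add: mult_single)

lemma single_expand:
  "Poly_Mapping.single m c = cst c * (\<Prod>v\<in>Poly_Mapping.keys m. indet v ^ Poly_Mapping.lookup m v)"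
  by (simp add: indet_power single_prod single_sum_expand cst_def mult_single)

lemma zpoly_induct [case_names const indet add mult]:
  fixes f :: "'n zpoly"
  assumes c: "\<And>c. P (cst c)" and i: "\<And>v. P (indet v)"
    and a: "\<And>f g. P f \<Longrightarrow> P g \<Longrightarrow> P (f + g)" and m: "\<And>f g. P f \<Longrightarrow> P g \<Longrightarrow> P (f * g)"
  shows "P f"
proof -
  have pow: "P (indet v ^ k)" for v k
    using c[of 1] by (induction k) (simp_all add: cst_simps i m)
  have pr: "P (\<Prod>v\<in>A. indet v ^ h v)" if "finite A" for A h
    using that c[of 1] by (induction rule: finite_induct) (simp_all add: cst_simps pow m)
  have mon: "P (Poly_Mapping.single k d)" for k d
    unfolding single_expand by (intro m c pr finite_keys)
  have "P (\<Sum>k\<in>A. Poly_Mapping.single k (h k))" if "finite A" for A h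
    using that c[of 0] by (induction rule: finite_induct) (simp_all add: cst_simps mon a)
  from this[of "Poly_Mapping.keys f" "Poly_Mapping.lookup f"] show ?thesis
    by (simp add: single_sum_expand)
qed

definition pdv :: "'n zvar \<Rightarrow> 'n zpoly \<Rightarrow> 'n zpoly" where
  "pdv v f = (\<Sum>m\<in>Poly_Mapping.keys f. Poly_Mapping.single (m - Poly_Mapping.single v 1)
                              (Poly_Mapping.lookup f m * of_nat (Poly_Mapping.lookup m v)))"

lemma pdv_add: "pdv v (f + g) = pdv v f + pdv v g"
  unfolding pdv_def
  by (rule setsum_keys_plus_distrib) (simp_all add: single_add distrib_right)

lemma pdv_0: "pdv v 0 = 0"
  by (simp add: pdv_def)

lemma pdv_single:
  "pdv v (Poly_Mapping.single m c) =
     Poly_Mapping.single (m - Poly_Mapping.single v 1) (c * of_nat (Poly_Mapping.lookup m v))"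
  by (simp add: pdv_def)

lemma pdv_mult_single:
  "pdv v (Poly_Mapping.single m c * Poly_Mapping.single m' d) =
     Poly_Mapping.single m c * pdv v (Poly_Mapping.single m' d)
     + pdv v (Poly_Mapping.single m c) * Poly_Mapping.single m' d"
proof -
  let ?e = "Poly_Mapping.single v (1::nat)"
  have 1: "m + (m' - ?e) = m + m' - ?e" if "Poly_Mapping.lookup m' v \<noteq> 0"
    by (rule poly_mapping_eqI) (use that in \<open>auto simp: lookup_add lookup_minus lookup_single when_def\<close>)
  have 2: "(m - ?e) + m' = m + m' - ?e" if "Poly_Mapping.lookup m v \<noteq> 0"
    by (rule poly_mapping_eqI) (use that in \<open>auto simp: lookup_add lookup_minus lookup_single when_def\<close>)
  show ?thesis
    using 1 2
    by (cases "Poly_Mapping.lookup m v = 0"; cases "Poly_Mapping.lookup m' v = 0")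
       (simp_all add: pdv_single mult_single lookup_add single_add[symmetric] algebra_simps)
qed

lemma pdv_sum: "pdv v (\<Sum>k\<in>A. h k) = (\<Sum>k\<in>A. pdv v (h k))"
  by (induction A rule: infinite_finite_induct) (simp_all add: pdv_0 pdv_add)

lemma pdv_mult: "pdv v (f * g) = f * pdv v g + pdv v f * g"
proof -
  let ?s = "\<lambda>f m. Poly_Mapping.single m (Poly_Mapping.lookup f m) :: 'a zpoly"
  have "pdv v ((\<Sum>m\<in>Poly_Mapping.keys f. ?s f m) * (\<Sum>k\<in>Poly_Mapping.keys g. ?s g k)) =
     (\<Sum>m\<in>Poly_Mapping.keys f. ?s f m) * pdv v (\<Sum>k\<in>Poly_Mapping.keys g. ?s g k)
     + pdv v (\<Sum>m\<in>Poly_Mapping.keys f. ?s f m) * (\<Sum>k\<in>Poly_Mapping.keys g. ?s g k)"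
    by (simp only: sum_product pdv_sum pdv_mult_single sum.distrib)
  then show ?thesis by (simp only: single_sum_expand)
qed

lemma pdv_cst: "pdv v (cst c) = 0"
  by (simp add: cst_def pdv_single)

lemma pdv_indet: "pdv v (indet w) = (if v = w then 1 else 0)"
  by (auto simp: indet_def pdv_single lookup_single when_def)

definition coord_bracket :: "'n::finite zpoly \<Rightarrow> 'n zpoly \<Rightarrow> 'n zpoly" where
  "coord_bracket f g =
     (\<Sum>j\<in>UNIV. zz j * zbar j * (pdv (Hol j) f * pdv (Anti j) g - pdv (Anti j) f * pdv (Hol j) g))"

lemma is_torus_bracket_coord: "is_torus_bracket (coord_bracket :: 'n::finite zpoly \<Rightarrow> _)"
proof -
  have anti: "coord_bracket f g = - coord_bracket g f" for f g :: "'n zpoly"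
    unfolding coord_bracket_def sum_negf[symmetric] by (rule sum.cong) (simp_all add: algebra_simps)
  have addl: "coord_bracket (f + g) h = coord_bracket f h + coord_bracket g h" for f g h :: "'n zpoly"
    unfolding coord_bracket_def sum.distrib[symmetric] by (rule sum.cong) (simp_all add: pdv_add algebra_simps)
  have leib: "coord_bracket (f * g) h = f * coord_bracket g h + coord_bracket f h * g" for f g h :: "'n zpoly"
    unfolding coord_bracket_def sum.distrib[symmetric] sum_distrib_left sum_distrib_right
    by (rule sum.cong) (simp_all add: pdv_mult algebra_simps)
  have scal: "coord_bracket (cst c * f) h = cst c * coord_bracket f h" for c and f h :: "'n zpoly"
    unfolding leib by (simp add: coord_bracket_def pdv_cst)
  have gens: "coord_bracket (zz j) (zbar k) = (if j = k then zz j * zbar j else 0)"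
    "coord_bracket (zz j) (zz k) = 0" "coord_bracket (zbar j) (zbar k) = 0" for j k :: 'n
    by (simp_all add: coord_bracket_def pdv_indet if_distrib[of "\<lambda>x. _ * x"] if_distrib[of "\<lambda>x. x * _"] cong: if_cong)
  show ?thesis
    unfolding is_torus_bracket_def using anti addl scal leib gens by blast
qed

lemma torus_bracket_unique:
  fixes B C :: "'n zpoly \<Rightarrow> 'n zpoly \<Rightarrow> 'n zpoly"
  assumes B: "is_torus_bracket B" and C: "is_torus_bracket C"
  shows "B = C"
proof -
  have anti: "D f g = - D g f" and addl: "D (f + g) h = D f h + D g h"
    and scal: "D (cst c * f) h = cst c * D f h"
    and leib: "D (f * g) h = f * D g h + D f h * g" if "is_torus_bracket D" for D and f g h :: "'a zpoly" and c
    using that unfolding is_torus_bracket_def by blast+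
  have cst0: "D (cst c) h = 0" if "is_torus_bracket D" for D and h :: "'n zpoly" and c
  proof -
    have "D 1 h = 0"
      using leib[OF that, of 1 1 h] by simp
    then show ?thesis
      using scal[OF that, of c 1 h] by simp
  qed
  have ii: "B (indet v) (indet w) = C (indet v) (indet w)" for v w
  proof (cases v; cases w)
    fix j k assume "v = Hol j" "w = Anti k"
    then show ?thesis using B C unfolding is_torus_bracket_def by metis
  next
    fix j k assume *: "v = Anti j" "w = Hol k"
    have "B (zz k) (zbar j) = C (zz k) (zbar j)"
      using B C unfolding is_torus_bracket_def by metis
    then show ?thesis using anti[OF B, of "indet v" "indet w"] anti[OF C, of "indet v" "indet w"] unfolding * by metis
  next
    fix j k assume "v = Hol j" "w = Hol k"
    then show ?thesis using B C unfolding is_torus_bracket_def by metis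
  next
    fix j k assume "v = Anti j" "w = Anti k"
    then show ?thesis using B C unfolding is_torus_bracket_def by metis
  qed
  have ig: "B (indet v) g = C (indet v) g" for v g
  proof -
    have "B g (indet v) = C g (indet v)"
      by (induction g rule: zpoly_induct) (simp_all add: cst0 ii B C addl leib)
    then show ?thesis using anti[OF B, of "indet v" g] anti[OF C, of "indet v" g] by metis
  qed
  have "B f g = C f g" for f g
    by (induction f rule: zpoly_induct) (simp_all add: cst0 ig B C addl leib)
  then show ?thesis by blast
qed

lemma ex1_torus_bracket: "\<exists>!B :: 'n::finite zpoly \<Rightarrow> 'n zpoly \<Rightarrow> 'n zpoly. is_torus_bracket B"
  using is_torus_bracket_coord torus_bracket_unique by blast

lemma poisson_eq_coord: "poisson = (coord_bracket :: 'n::finite zpoly \<Rightarrow> _)"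
  unfolding poisson_def
  by (rule the_equality) (blast intro: is_torus_bracket_coord torus_bracket_unique)+

lemma is_torus_bracket_poisson: "is_torus_bracket (poisson :: 'n::finite zpoly \<Rightarrow> _)"
  by (simp add: poisson_eq_coord is_torus_bracket_coord)

lemma poisson_anti: "poisson f g = - poisson g (f :: 'n::finite zpoly)"
  and poisson_add_left: "poisson (f + g) h = poisson f h + poisson g (h :: 'n::finite zpoly)"
  and poisson_mult_left: "poisson (f * g) h = f * poisson g h + poisson f h * (g :: 'n::finite zpoly)"
  using is_torus_bracket_poisson[where 'n='n] unfolding is_torus_bracket_def by blast+

lemma poisson_cst_left: "poisson (cst c) (h :: 'n::finite zpoly) = 0"
  by (simp add: poisson_eq_coord coord_bracket_def pdv_cst)

lemma poisson_cst_right: "poisson (h :: 'n::finite zpoly) (cst c) = 0"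
  by (simp add: poisson_eq_coord coord_bracket_def pdv_cst)

lemma poisson_add_right: "poisson h (f + g) = poisson h f + poisson h (g :: 'n::finite zpoly)"
  using poisson_add_left[of f g h] by (metis poisson_anti minus_add_distrib)

lemma poisson_mult_right: "poisson h (f * g) = f * poisson h g + poisson h f * (g :: 'n::finite zpoly)"
proof -
  have "poisson h (f * g) = - (f * poisson g h + poisson f h * g)"
    by (metis poisson_anti poisson_mult_left)
  then show ?thesis
    by (simp add: poisson_anti[of g h] poisson_anti[of f h])
qed

lemma poisson_gens:
  "poisson (zz j) (zbar k) = (if j = k then zz j * zbar j else 0)"
  "poisson (zz j) (zz k) = 0"
  "poisson (zbar j) (zbar k) = 0"
  "poisson (zbar j) (zz k) = (if j = k then - (zz j * zbar j) else (0 :: 'n::finite zpoly))"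
proof -
  show 1: "poisson (zz j) (zbar k) = (if j = k then zz j * zbar j else 0)" for j k :: 'n
    using is_torus_bracket_poisson[where 'n='n] unfolding is_torus_bracket_def by blast
  show "poisson (zz j) (zz k) = 0" "poisson (zbar j) (zbar k) = 0"
    using is_torus_bracket_poisson[where 'n='n] unfolding is_torus_bracket_def by blast+
  show "poisson (zbar j) (zz k) = (if j = k then - (zz j * zbar j) else 0)"
    using 1[of k j] by (simp add: poisson_anti[of "zbar j" "zz k"])
qed

lemma poisson_minus_right: "poisson h (- g) = - poisson h (g :: 'n::finite zpoly)"
  using poisson_add_right[of h g "- g"] poisson_cst_right[of h 0]
  by (simp add: cst_simps eq_neg_iff_add_eq_0 add.commute)

lemma poisson_diff_right: "poisson h (f - g) = poisson h f - poisson h (g :: 'n::finite zpoly)"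
  using poisson_add_right[of h f "- g"] by (simp add: poisson_minus_right)

lemma poisson_zero_right: "poisson h (0 :: 'n::finite zpoly) = 0"
  using poisson_cst_right[of h 0] by (simp add: cst_simps)

definition jac :: "'n::finite zpoly \<Rightarrow> 'n zpoly \<Rightarrow> 'n zpoly \<Rightarrow> 'n zpoly" where
  "jac f g h = poisson f (poisson g h) + poisson g (poisson h f) + poisson h (poisson f g)"

lemma jac_rotate: "jac f g h = jac g h f"
  by (simp add: jac_def ac_simps)

lemma jac_cst: "jac (cst c) g h = 0"
  by (simp add: jac_def poisson_cst_left poisson_cst_right poisson_zero_right)

lemma jac_add: "jac (f + f') g h = jac f g h + jac f' g h"
  by (simp add: jac_def poisson_add_left poisson_add_right)

lemma jac_mult: "jac (f * f') g h = f * jac f' g h + jac f g h * f'"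
  by (simp add: jac_def poisson_mult_left poisson_mult_right poisson_add_right
      poisson_anti[of f g] poisson_anti[of f' g] poisson_anti[of h f] poisson_anti[of h f']
      poisson_minus_right poisson_diff_right algebra_simps)

lemma jac_gens: "jac (indet u) (indet v) (indet w) = 0"
  by (cases u; cases v; cases w)
     (auto simp: jac_def poisson_gens poisson_mult_right poisson_minus_right poisson_zero_right algebra_simps)

lemma poisson_jacobi:
  fixes f g h :: "'n::finite zpoly"
  shows "poisson f (poisson g h) + poisson g (poisson h f) + poisson h (poisson f g) = 0"
proof -
  have 1: "jac f (indet v) (indet w) = 0" for f :: "'n zpoly" and v w
    by (induction f rule: zpoly_induct) (simp_all add: jac_cst jac_add jac_mult jac_gens)
  have 2: "jac g (indet w) f = 0" for f g :: "'n zpoly" and w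
  proof (induction g rule: zpoly_induct)
    case (indet v) then show ?case using 1[of f v w] by (metis jac_rotate)
  qed (simp_all add: jac_cst jac_add jac_mult)
  have "jac h f g = 0" for f g h :: "'n zpoly"
  proof (induction h rule: zpoly_induct)
    case (indet v) then show ?case using 2[of g v f] by (metis jac_rotate)
  qed (simp_all add: jac_cst jac_add jac_mult)
  from this[of f g h] show ?thesis by (simp add: jac_def)
qed

end

theory Submission
  imports Defs "HOL-Library.Product_Plus" "HOL-Combinatorics.Multiset_Permutations"
begin

text \<open>
Write \<open>p(a, b) = \<Sum>\<^sub>j z\<^sub>j\<^sup>a zbar\<^sub>j\<^sup>b\<close> for the polarized power sums. Two facts carry the theorem:
the polarized power sums generate the bisymmetric polynomials as an algebra, and all of them arise
from the pure ones \<open>p(a, 0)\<close> and \<open>p(0, b)\<close> by a single bracket, because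
\<open>{p(a, b), p(c, d)} = (a d - b c) p(a + c, b + d)\<close>
(\<open>poisson_polarized_power_sum\<close>), hence \<open>{p(a, 0), p(0, b)} = a b p(a, b)\<close>.

Both the first fact and the passage between pure power sums and elementary symmetric functions are
read off from one family of symmetric polynomials. For a list \<open>[\<alpha>\<^sub>1, \<dots>, \<alpha>\<^sub>r]\<close> of exponent pairs, let
\<open>M[\<alpha>\<^sub>1, \<dots>, \<alpha>\<^sub>r]\<close> be the sum, over all lists of distinct indices \<open>j\<^sub>1, \<dots>, j\<^sub>r\<close>, of the product of the
monomials with exponents \<open>\<alpha>\<^sub>i\<close> in the variables of index \<open>j\<^sub>i\<close>. Multiplying by \<open>p(\<beta>)\<close> chooses one more
index, which is either new or equal to one of the \<open>j\<^sub>i\<close>, so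
\<open>p(\<beta>) M[\<alpha>\<^sub>1, \<dots>, \<alpha>\<^sub>r] = M[\<beta>, \<alpha>\<^sub>1, \<dots>, \<alpha>\<^sub>r] + \<Sum>\<^sub>i M[\<alpha>\<^sub>1, \<dots>, \<alpha>\<^sub>i + \<beta>, \<dots>, \<alpha>\<^sub>r]\<close>
(\<open>polarized_power_sum_mult_arrangement_sum\<close>). This relation is used in two directions.

\<^item> Solved for its first summand on the right, it expresses every \<open>M\<close> through polarized power sums by
  induction on the length (\<open>arrangement_sum_mem\<close>). Averaging a monomial over the symmetric group
  gives a scalar multiple of an \<open>M\<close> of full length, so the polarized power sums generate all
  bisymmetric polynomials. Moreover \<open>M[(1, 0), \<dots>, (1, 0)]\<close> with \<open>r\<close> entries is \<open>r!\<close> times the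
  elementary symmetric function \<open>\<sigma>\<^sub>r\<close>, and only \<open>\<tau>\<^sub>1, \<dots>, \<tau>\<^sub>r\<close> occur in its expression.

\<^item> Solved for the sum on the right, with \<open>\<alpha>\<^sub>i = (1, 0)\<close> for all \<open>i\<close> and \<open>\<beta> = (a, 0)\<close>, it expresses
  \<open>M[(a + 1, 0), (1, 0), \<dots>, (1, 0)]\<close> through \<open>M\<close>'s whose first entry is \<open>(a, 0)\<close>. An induction on
  \<open>a\<close> yields every pure power sum \<open>p(a, 0) = M[(a, 0)]\<close>, of arbitrarily high degree, from the
  elementary symmetric functions (\<open>polarized_power_sum_multiple_mem\<close>). This replaces Newton's
  identities.

So a Poisson subalgebra containing \<open>\<tau>\<^sub>1, \<dots>, \<tau>\<^sub>n\<close> and their conjugates contains all \<open>\<sigma>\<^sub>r\<close> and their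
conjugates, therefore all pure power sums, therefore all \<open>p(a, b)\<close>, therefore everything
bisymmetric. The reverse inclusion holds since the symmetric group acts by Poisson automorphisms.
By the Leibniz rule, the algebra generated by the iterated brackets of a set is closed under the
bracket and thus equals the Poisson algebra generated by that set.
\<close>


section \<open>Polarized power sums and sums over arrangements\<close>

definition bimonomial :: "nat \<times> nat \<Rightarrow> 'n \<Rightarrow> 'n zpoly" where
  "bimonomial \<alpha> j = zz j ^ fst \<alpha> * zbar j ^ snd \<alpha>"

definition polarized_power_sum :: "nat \<times> nat \<Rightarrow> 'n::finite zpoly" where
  "polarized_power_sum \<alpha> = (\<Sum>j\<in>UNIV. bimonomial \<alpha> j)"

definition arrangements :: "nat \<Rightarrow> 'a list set" where
  "arrangements r = {js. length js = r \<and> distinct js}"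

definition arrangement_term :: "(nat \<times> nat) list \<Rightarrow> 'n list \<Rightarrow> 'n zpoly" where
  "arrangement_term xs js = prod_list (map2 bimonomial xs js)"

text \<open>This is \<open>M xs\<close> of the introduction. For lists that are not longer than the number of indices it is
a positive integer multiple of a monomial symmetric function in two sets of variables. Summing over index lists instead of over distinct monomials keeps the
multiplicities uniform, at the price of factorials that are invertible over the rationals.\<close>

definition arrangement_sum :: "(nat \<times> nat) list \<Rightarrow> 'n::finite zpoly" where
  "arrangement_sum xs = (\<Sum>js\<in>arrangements (length xs). arrangement_term xs js)"

lemma bimonomial_add: "bimonomial (\<alpha> + \<beta>) j = bimonomial \<alpha> j * bimonomial \<beta> j"
  by (simp add: bimonomial_def power_add ac_simps)

lemma finite_arrangements [simp]: "finite (arrangements r :: 'a::finite list set)"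
proof (rule finite_subset)
  show "arrangements r \<subseteq> {js :: 'a list. set js \<subseteq> UNIV \<and> length js = r}"
    by (auto simp: arrangements_def)
  show "finite {js :: 'a list. set js \<subseteq> UNIV \<and> length js = r}"
    by (rule finite_lists_length_eq) simp
qed

lemma arrangement_sum_Nil: "arrangement_sum [] = (1 :: 'n::finite zpoly)"
proof -
  have "arrangements 0 = {[] :: 'n list}"
    by (auto simp: arrangements_def)
  then show ?thesis
    by (simp add: arrangement_sum_def arrangement_term_def)
qed

lemma arrangement_term_update:
  assumes "length js = length xs" "i < length xs"
  shows "arrangement_term (xs[i := xs ! i + \<beta>]) js = bimonomial \<beta> (js ! i) * arrangement_term xs js"
  using assms
proof (induction xs js arbitrary: i rule: list_induct2')
  case (4 x xs j js)
  then show ?case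
    by (cases i) (simp_all add: arrangement_term_def bimonomial_add ac_simps)
qed auto

text \<open>An arrangement of length one more is an arrangement together with a new first index.\<close>

lemma arrangement_sum_Cons:
  "arrangement_sum (\<beta> # xs) =
    (\<Sum>js\<in>arrangements (length xs). \<Sum>j\<in>- set js. bimonomial \<beta> j * arrangement_term xs js :: 'n::finite zpoly)"
proof -
  let ?S = "SIGMA js:(arrangements (length xs) :: 'n list set). - set js"
  have "bij_betw (\<lambda>(js, j). j # js) ?S (arrangements (Suc (length xs)))"
    by (rule bij_betwI[of _ _ _ "\<lambda>l. (tl l, hd l)"])
       (auto simp: arrangements_def length_Suc_conv)
  then have "arrangement_sum (\<beta> # xs) = (\<Sum>(js, j)\<in>?S. arrangement_term (\<beta> # xs) (j # js))"
    using sum.reindex_bij_betw[of "\<lambda>(js, j). j # js" ?S "arrangements (Suc (length xs))"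
        "arrangement_term (\<beta> # xs) :: 'n list \<Rightarrow> 'n zpoly"]
    by (simp add: arrangement_sum_def case_prod_unfold)
  also have "\<dots> = (\<Sum>js\<in>arrangements (length xs). \<Sum>j\<in>- set js. arrangement_term (\<beta> # xs) (j # js))"
    by (subst sum.Sigma) auto
  finally show ?thesis
    by (simp add: arrangement_term_def)
qed

text \<open>The index of the power sum either avoids the arrangement, and extends it, or hits exactly one of its
positions because the entries are distinct; in the latter case it adds to the exponent there.\<close>

lemma polarized_power_sum_mult_arrangement_sum:
  "polarized_power_sum \<beta> * arrangement_sum xs =
    arrangement_sum (\<beta> # xs) +
    (\<Sum>i<length xs. arrangement_sum (xs[i := xs ! i + \<beta>]) :: 'n::finite zpoly)"
proof -
  have split: "(\<Sum>j\<in>UNIV. bimonomial \<beta> j * arrangement_term xs js) =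
      (\<Sum>j\<in>- set js. bimonomial \<beta> j * arrangement_term xs js)
      + (\<Sum>i<length xs. arrangement_term (xs[i := xs ! i + \<beta>]) js)"
    if js: "js \<in> arrangements (length xs)" for js :: "'n list"
  proof -
    have len: "length js = length xs" and dist: "distinct js"
      using js by (auto simp: arrangements_def)
    have "bij_betw ((!) js) {..<length xs} (set js)"
      using bij_betw_nth[OF dist] len by simp
    then have "(\<Sum>j\<in>set js. bimonomial \<beta> j * arrangement_term xs js)
        = (\<Sum>i<length xs. bimonomial \<beta> (js ! i) * arrangement_term xs js)"
      by (simp add: sum.reindex_bij_betw[symmetric])
    also have "\<dots> = (\<Sum>i<length xs. arrangement_term (xs[i := xs ! i + \<beta>]) js)"
      by (simp add: arrangement_term_update len)
    finally show ?thesis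
      by (subst sum.subset_diff[of "set js"]) (auto simp: Compl_eq_Diff_UNIV)
  qed
  have "polarized_power_sum \<beta> * (arrangement_sum xs :: 'n zpoly) =
      (\<Sum>js\<in>arrangements (length xs). \<Sum>j\<in>UNIV. bimonomial \<beta> j * arrangement_term xs js)"
    by (simp add: polarized_power_sum_def arrangement_sum_def sum_product sum.swap[of _ UNIV])
  also have "\<dots> = (\<Sum>js\<in>arrangements (length xs).
      (\<Sum>j\<in>- set js. bimonomial \<beta> j * arrangement_term xs js)
      + (\<Sum>i<length xs. arrangement_term (xs[i := xs ! i + \<beta>]) js))"
    by (rule sum.cong[OF refl split])
  also have "\<dots> = arrangement_sum (\<beta> # xs)
      + (\<Sum>js\<in>arrangements (length xs). \<Sum>i<length xs. arrangement_term (xs[i := xs ! i + \<beta>]) js)"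
    by (simp add: sum.distrib arrangement_sum_Cons)
  also have "(\<Sum>js\<in>arrangements (length xs). \<Sum>i<length xs. arrangement_term (xs[i := xs ! i + \<beta>]) js)
      = (\<Sum>i<length xs. arrangement_sum (xs[i := xs ! i + \<beta>]))"
    by (subst sum.swap) (simp add: arrangement_sum_def)
  finally show ?thesis .
qed

text \<open>Permuting the exponents can be undone by permuting the index lists, which only reorders the summands.\<close>

lemma arrangement_sum_cong_mset:
  assumes "mset xs = mset ys"
  shows "arrangement_sum xs = (arrangement_sum ys :: 'n::finite zpoly)"
proof -
  obtain p where p: "p permutes {..<length ys}" and xs: "permute_list p ys = xs"
    using mset_eq_permutation[OF assms] .
  let ?A = "arrangements (length ys) :: 'n list set"
  have "inj_on (permute_list p) ?A"
  proof (rule inj_on_inverseI)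
    fix js :: "'n list" assume "js \<in> ?A"
    then have "permute_list (inv p) (permute_list p js) = permute_list (p \<circ> inv p) js"
      using permute_list_compose[of "inv p" js p] permutes_inv[OF p] by (simp add: arrangements_def)
    then show "permute_list (inv p) (permute_list p js) = js"
      using p by (simp add: permutes_inv_o)
  qed
  moreover have "permute_list p ` ?A \<subseteq> ?A"
    using p by (auto simp: arrangements_def)
  ultimately have bij: "bij_betw (permute_list p) ?A ?A"
    by (simp add: bij_betw_def endo_inj_surj)
  have "arrangement_term xs (permute_list p js) = arrangement_term ys js" if "js \<in> ?A" for js
  proof -
    have len: "length js = length ys"
      using that by (simp add: arrangements_def)
    have "zip xs (permute_list p js) = permute_list p (zip ys js)"
      unfolding xs[symmetric] by (rule permute_list_zip[OF p refl len[symmetric], symmetric])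
    then have "mset (zip xs (permute_list p js)) = mset (zip ys js)"
      using p len by simp
    then have "mset (map2 bimonomial xs (permute_list p js)) = mset (map2 bimonomial ys js)"
      by simp
    then show ?thesis
      unfolding arrangement_term_def prod_mset_prod_list[symmetric] by simp
  qed
  then show ?thesis
    using sum.reindex_bij_betw[OF bij, of "arrangement_term xs"] mset_eq_length[OF assms]
    by (simp add: arrangement_sum_def)
qed

text \<open>Each subset with \<open>r\<close> elements is enumerated by \<open>r!\<close> arrangements, all with the same product.\<close>

lemma sum_prod_arrangements:
  fixes h :: "'n::finite \<Rightarrow> 'n zpoly"
  shows "(\<Sum>js\<in>arrangements r. prod_list (map h js)) =
    of_nat (fact r) * (\<Sum>A | card A = r. \<Prod>j\<in>A. h j)"
proof -
  have U: "arrangements r = (\<Union>A\<in>{A. card A = r}. permutations_of_set A)"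
    by (auto simp: arrangements_def permutations_of_set_def distinct_card)
  have "(\<Sum>js\<in>arrangements r. prod_list (map h js)) =
      (\<Sum>A | card A = r. \<Sum>js\<in>permutations_of_set A. prod_list (map h js))"
    unfolding U by (rule sum.UNION_disjoint) (auto dest: permutations_of_setD)
  also have "\<dots> = (\<Sum>A | card A = r. of_nat (fact r) * (\<Prod>j\<in>A. h j))"
  proof (rule sum.cong[OF refl])
    fix A :: "'n set" assume A: "A \<in> {A. card A = r}"
    have "(\<Sum>js\<in>permutations_of_set A. prod_list (map h js)) = (\<Sum>js\<in>permutations_of_set A. \<Prod>j\<in>A. h j)"
      by (rule sum.cong) (auto simp: permutations_of_set_def prod.distinct_set_conv_list)
    then show "(\<Sum>js\<in>permutations_of_set A. prod_list (map h js)) = of_nat (fact r) * (\<Prod>j\<in>A. h j)"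
      using A by simp
  qed
  finally show ?thesis
    by (simp add: sum_distrib_left)
qed

lemma arrangement_term_replicate:
  "length js = r \<Longrightarrow> arrangement_term (replicate r \<alpha>) js = prod_list (map (bimonomial \<alpha>) js)"
  by (induction js arbitrary: r) (auto simp: arrangement_term_def)

lemma arrangement_sum_replicate:
  "arrangement_sum (replicate r \<alpha>) = of_nat (fact r) * (\<Sum>A | card A = r. \<Prod>j\<in>A. bimonomial \<alpha> j)"
proof -
  have "arrangement_sum (replicate r \<alpha>) = (\<Sum>js\<in>arrangements r. prod_list (map (bimonomial \<alpha>) js))"
    unfolding arrangement_sum_def
    by (rule sum.cong) (auto simp: arrangements_def arrangement_term_replicate)
  then show ?thesis
    by (simp add: sum_prod_arrangements)
qed

lemma power_sum_polarized:
  "power_sum k = polarized_power_sum (k, 0)" "power_sum_bar k = polarized_power_sum (0, k)"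
  by (simp_all add: power_sum_def power_sum_bar_def polarized_power_sum_def bimonomial_def)

lemma arrangement_sum_elem_sym:
  "arrangement_sum (replicate r (1, 0)) = of_nat (fact r) * elem_sym r"
  "arrangement_sum (replicate r (0, 1)) = of_nat (fact r) * elem_sym_bar r"
  by (simp_all add: arrangement_sum_replicate elem_sym_def elem_sym_bar_def bimonomial_def)

text \<open>Elementary symmetric functions of degree zero or above the number of variables are constants, so
memberships have to be assumed only in degrees \<open>1, \<dots>, n\<close>.\<close>

lemma elem_sym_outside:
  assumes "r \<notin> {1..CARD('n)}"
  shows "(elem_sym r :: 'n::finite zpoly) \<in> {0, 1}" "(elem_sym_bar r :: 'n zpoly) \<in> {0, 1}"
proof -
  consider "r = 0" | "r > CARD('n)"
    using assms by force
  then have "(elem_sym r :: 'n zpoly) \<in> {0, 1} \<and> (elem_sym_bar r :: 'n zpoly) \<in> {0, 1}"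
  proof cases
    case 1
    then show ?thesis by (simp add: elem_sym_def elem_sym_bar_def card_eq_0_iff)
  next
    case 2
    moreover have "card A \<le> CARD('n)" for A :: "'n set"
      by (rule card_mono) auto
    ultimately have "{A :: 'n set. card A = r} = {}"
      by (metis (mono_tags) empty_Collect_eq leD)
    then show ?thesis by (simp add: elem_sym_def elem_sym_bar_def)
  qed
  then show "(elem_sym r :: 'n::finite zpoly) \<in> {0, 1}" "(elem_sym_bar r :: 'n zpoly) \<in> {0, 1}"
    by simp_all
qed


section \<open>Subalgebras\<close>

lemma cst_of_nat: "cst (of_nat k) = of_nat k"
  by (induction k) (simp_all add: cst_simps)

locale subalgebra =
  fixes A :: "'n::finite zpoly set"
  assumes cst_mem [simp]: "cst c \<in> A"
    and add_mem: "f \<in> A \<Longrightarrow> g \<in> A \<Longrightarrow> f + g \<in> A"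
    and mult_mem: "f \<in> A \<Longrightarrow> g \<in> A \<Longrightarrow> f * g \<in> A"
begin

lemma zero_mem [simp]: "0 \<in> A" and one_mem [simp]: "1 \<in> A" and of_nat_mem [simp]: "of_nat k \<in> A"
  using cst_mem[of 0] cst_mem[of 1] cst_mem[of "of_nat k"] by (simp_all add: cst_simps cst_of_nat)

lemma minus_mem: "f \<in> A \<Longrightarrow> - f \<in> A"
proof -
  have "cst (- 1) + cst 1 = (0 :: 'n zpoly)"
    by (simp only: cst_simps(3)[symmetric]) (simp add: cst_simps(1))
  then have "cst (- 1) = (- 1 :: 'n zpoly)"
    by (simp add: cst_simps eq_neg_iff_add_eq_0)
  then show "f \<in> A \<Longrightarrow> - f \<in> A"
    using mult_mem[OF cst_mem[of "- 1"], of f] by simp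
qed

lemma diff_mem: "f \<in> A \<Longrightarrow> g \<in> A \<Longrightarrow> f - g \<in> A"
  using add_mem[of f "- g"] minus_mem[of g] by simp

lemma sum_mem: "(\<And>i. i \<in> I \<Longrightarrow> f i \<in> A) \<Longrightarrow> sum f I \<in> A"
  by (induction I rule: infinite_finite_induct) (auto intro: add_mem)

lemma of_nat_mult_cancel:
  assumes "of_nat k * f \<in> A" "k \<noteq> 0"
  shows "f \<in> A"
proof -
  have "cst (1 / of_nat k) * (of_nat k * f) \<in> A"
    by (rule mult_mem[OF cst_mem assms(1)])
  also have "cst (1 / of_nat k) * (of_nat k * f) = cst (1 / of_nat k * of_nat k) * f"
    by (simp only: cst_simps cst_of_nat mult.assoc)
  finally show ?thesis
    using assms(2) by (simp add: cst_simps)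
qed

text \<open>Every power sum in the expansion of \<open>arrangement_sum xs\<close> has as exponent the sum of some of the
entries of \<open>xs\<close>. The bound \<open>\<theta>\<close> records this: the exponents that occur are below \<open>\<theta>\<close> in the natural
order of the monoid. In the induction step the total exponent stays below the same \<open>\<theta>\<close>, whether an entry is
split off or merged into another one.\<close>

lemma arrangement_sum_mem:
  assumes p: "\<And>\<gamma> \<delta>. \<gamma> + \<delta> = \<theta> \<Longrightarrow> polarized_power_sum \<gamma> \<in> A"
    and "sum_list xs + \<delta> = \<theta>"
  shows "arrangement_sum xs \<in> A"
  using assms(2)
proof (induction "length xs" arbitrary: xs \<delta>)
  case 0
  then show ?case
    by (simp add: arrangement_sum_Nil)
next
  case (Suc r)
  then obtain \<beta> ys where xs: "xs = \<beta> # ys" and r: "r = length ys"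
    by (metis length_Suc_conv)
  have upd: "sum_list (ys[i := ys ! i + \<beta>]) = \<beta> + sum_list ys" if "i < length ys" for i
    using that by (induction ys arbitrary: i) (auto simp: nth_Cons ac_simps split: nat.splits)
  have "polarized_power_sum \<beta> \<in> A"
    using p[of \<beta> "sum_list ys + \<delta>"] Suc.prems by (simp add: xs ac_simps)
  moreover have "arrangement_sum ys \<in> A"
    using Suc.hyps(1)[OF r, of "\<beta> + \<delta>"] Suc.prems by (simp add: xs ac_simps)
  moreover have "(\<Sum>i<length ys. arrangement_sum (ys[i := ys ! i + \<beta>])) \<in> A"
    by (rule sum_mem, rule Suc.hyps(1)[of _ \<delta>]) (use Suc.prems in \<open>auto simp: xs r upd\<close>)
  ultimately have "polarized_power_sum \<beta> * arrangement_sum ys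
      - (\<Sum>i<length ys. arrangement_sum (ys[i := ys ! i + \<beta>])) \<in> A"
    by (intro diff_mem mult_mem)
  then show ?case
    by (simp add: polarized_power_sum_mult_arrangement_sum xs)
qed

text \<open>The sums \<open>arrangement_sum (replicate r \<beta>)\<close> are multiples of the elementary symmetric functions in the
monomials of exponent \<open>\<beta>\<close>, and the conclusion concerns the power sums of the same monomials. The
induction has to run over all lists with first entry \<open>k \<beta>\<close> followed by \<open>r\<close> copies of \<open>\<beta>\<close>, for every
\<open>r\<close> at once, since raising the first entry consumes one of the copies.\<close>

lemma polarized_power_sum_multiple_mem:
  assumes e: "\<And>r. arrangement_sum (replicate r \<beta>) \<in> A"
  shows "polarized_power_sum (((+) \<beta> ^^ k) 0) \<in> A"
proof -
  define m where "m k = ((+) \<beta> ^^ k) 0" for k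
  have single: "arrangement_sum [\<alpha>] = (polarized_power_sum \<alpha> :: 'n zpoly)" for \<alpha>
    using polarized_power_sum_mult_arrangement_sum[of \<alpha> "[]", where 'n='n]
    by (simp add: arrangement_sum_Nil)
  have "\<forall>r. arrangement_sum (m (Suc k) # replicate r \<beta>) \<in> A" for k
  proof (induction k)
    case 0
    show ?case using e[of "Suc _"] by (simp add: m_def)
  next
    case (Suc k)
    show ?case
    proof
      fix r
      let ?R = "replicate (Suc r) \<beta>"
      have p: "polarized_power_sum (m (Suc k)) \<in> A"
        using Suc[rule_format, of 0] by (simp add: single)
      \<comment> \<open>Merging the power sum into any of the equal entries gives the same multiset of exponents.\<close>
      have "arrangement_sum (?R[i := ?R ! i + m (Suc k)])
          = (arrangement_sum (m (Suc (Suc k)) # replicate r \<beta>) :: 'n zpoly)" if "i < Suc r" for i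
        by (rule arrangement_sum_cong_mset) (use that in \<open>simp add: mset_update m_def del: replicate_Suc\<close>)
      then have "polarized_power_sum (m (Suc k)) * arrangement_sum ?R =
          arrangement_sum (m (Suc k) # ?R)
          + of_nat (Suc r) * (arrangement_sum (m (Suc (Suc k)) # replicate r \<beta>) :: 'n zpoly)"
        unfolding polarized_power_sum_mult_arrangement_sum by simp
      then have "of_nat (Suc r) * (arrangement_sum (m (Suc (Suc k)) # replicate r \<beta>) :: 'n zpoly)
          = polarized_power_sum (m (Suc k)) * arrangement_sum ?R - arrangement_sum (m (Suc k) # ?R)"
        by (simp add: algebra_simps)
      also have "\<dots> \<in> A"
        by (intro diff_mem mult_mem p e Suc[rule_format])
      finally show "arrangement_sum (m (Suc (Suc k)) # replicate r \<beta>) \<in> A"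
        by (rule of_nat_mult_cancel) simp
    qed
  qed
  from this[rule_format, of _ 0] have "polarized_power_sum (m (Suc k)) \<in> A" for k
    by (simp add: single)
  moreover have "polarized_power_sum (m 0) \<in> A"
    by (simp add: m_def polarized_power_sum_def bimonomial_def)
  ultimately show ?thesis
    by (cases k) (simp_all add: m_def)
qed

lemma replicate_unit_mem_if_elem_sym:
  assumes "elem_sym ` {1..CARD('n)} \<union> elem_sym_bar ` {1..CARD('n)} \<subseteq> A"
  shows "arrangement_sum (replicate r (1, 0)) \<in> A" "arrangement_sum (replicate r (0, 1)) \<in> A"
proof -
  have "elem_sym r \<in> A \<and> elem_sym_bar r \<in> A"
  proof (cases "r \<in> {1..CARD('n)}")
    case True
    then show ?thesis using assms by blast
  next
    case False
    then show ?thesis using elem_sym_outside[OF False] zero_mem one_mem by (metis empty_iff insert_iff)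
  qed
  then show "arrangement_sum (replicate r (1, 0)) \<in> A" "arrangement_sum (replicate r (0, 1)) \<in> A"
    unfolding arrangement_sum_elem_sym by (blast intro: mult_mem of_nat_mem)+
qed

text \<open>Taking \<open>\<theta> = (r, 0)\<close> as the bound in \<open>arrangement_sum_mem\<close> ensures that \<open>\<sigma>\<^sub>r\<close> involves no power sums
beyond \<open>\<tau>\<^sub>1, \<dots>, \<tau>\<^sub>r\<close> and the constant \<open>n\<close>.\<close>

lemma elem_sym_mem_if_power_sums:
  assumes "power_sum ` {1..CARD('n)} \<union> power_sum_bar ` {1..CARD('n)} \<subseteq> A"
  shows "elem_sym ` {1..CARD('n)} \<union> elem_sym_bar ` {1..CARD('n)} \<subseteq> A"
proof -
  have zero: "polarized_power_sum (0, 0) \<in> A"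
    by (simp add: polarized_power_sum_def bimonomial_def)
  have "elem_sym r \<in> A \<and> elem_sym_bar r \<in> A" if r: "r \<in> {1..CARD('n)}" for r
  proof -
    have sl: "sum_list (replicate r (1, 0)) = (r, 0 :: nat)" "sum_list (replicate r (0, 1)) = (0 :: nat, r)"
      by (induction r) (simp_all add: zero_prod_def)
    have hol: "polarized_power_sum \<gamma> \<in> A" if "\<gamma> + \<delta> = (r, 0)" for \<gamma> \<delta>
    proof -
      have "snd \<gamma> = 0" "fst \<gamma> \<le> CARD('n)"
        using that r by (auto simp: prod_eq_iff)
      then show ?thesis
        using assms zero by (cases \<gamma>; cases "fst \<gamma>") (auto simp: power_sum_polarized)
    qed
    have bar: "polarized_power_sum \<gamma> \<in> A" if "\<gamma> + \<delta> = (0, r)" for \<gamma> \<delta>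
    proof -
      have "fst \<gamma> = 0" "snd \<gamma> \<le> CARD('n)"
        using that r by (auto simp: prod_eq_iff)
      then show ?thesis
        using assms zero by (cases \<gamma>; cases "snd \<gamma>") (auto simp: power_sum_polarized)
    qed
    have "arrangement_sum (replicate r (1, 0)) \<in> A"
      by (rule arrangement_sum_mem[OF hol, where \<delta> = 0]) (simp_all only: sl add_0_right)
    moreover have "arrangement_sum (replicate r (0, 1)) \<in> A"
      by (rule arrangement_sum_mem[OF bar, where \<delta> = 0]) (simp_all only: sl add_0_right)
    ultimately show ?thesis
      unfolding arrangement_sum_elem_sym by (metis of_nat_mult_cancel fact_nonzero)
  qed
  then show ?thesis by blast
qed

end


section \<open>The action of the symmetric group\<close>

lemma poly_subst_add: "poly_subst s (f + g) = poly_subst s f + poly_subst s g"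
  unfolding poly_subst_def
  by (rule setsum_keys_plus_distrib) (simp_all add: cst_simps distrib_right)

lemma poly_subst_zero: "poly_subst s 0 = 0"
  by (simp add: poly_subst_def)

lemma poly_subst_sum: "poly_subst s (\<Sum>k\<in>I. h k) = (\<Sum>k\<in>I. poly_subst s (h k))"
  by (induction I rule: infinite_finite_induct) (simp_all add: poly_subst_zero poly_subst_add)

lemma poly_subst_single:
  "poly_subst s (Poly_Mapping.single m c) = cst c * (\<Prod>v\<in>UNIV. s v ^ Poly_Mapping.lookup m v)"
  if "finite (UNIV :: 'n zvar set)" for s :: "'n zvar \<Rightarrow> 'n zpoly"
proof -
  have "(\<Prod>v\<in>Poly_Mapping.keys m. s v ^ Poly_Mapping.lookup m v) = (\<Prod>v\<in>UNIV. s v ^ Poly_Mapping.lookup m v)"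
    by (rule prod.mono_neutral_left) (use that in \<open>auto simp: in_keys_iff\<close>)
  then show ?thesis
    by (cases "c = 0") (simp_all add: poly_subst_def cst_simps)
qed

lemma UNIV_zvar: "(UNIV :: 'n zvar set) = range Hol \<union> range Anti"
  by (auto, metis rangeI zvar.exhaust)

lemma finite_zvar: "finite (UNIV :: 'n::finite zvar set)"
  by (simp add: UNIV_zvar)

lemma poly_subst_mult:
  fixes s :: "'n::finite zvar \<Rightarrow> 'n zpoly"
  shows "poly_subst s (f * g) = poly_subst s f * poly_subst s g"
proof -
  let ?s = "\<lambda>f m. Poly_Mapping.single m (Poly_Mapping.lookup f m) :: 'n zpoly"
  have "poly_subst s ((\<Sum>m\<in>Poly_Mapping.keys f. ?s f m) * (\<Sum>k\<in>Poly_Mapping.keys g. ?s g k)) =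
     poly_subst s (\<Sum>m\<in>Poly_Mapping.keys f. ?s f m) * poly_subst s (\<Sum>k\<in>Poly_Mapping.keys g. ?s g k)"
    by (simp add: sum_product poly_subst_sum mult_single poly_subst_single[OF finite_zvar]
        lookup_add power_add prod.distrib cst_simps ac_simps)
  then show ?thesis by (simp only: single_sum_expand)
qed

lemma poly_subst_indet: "poly_subst s (indet v) = s v"
  by (simp add: poly_subst_def indet_def cst_simps)

lemma poly_subst_cst: "poly_subst s (cst c) = cst c"
  by (cases "c = 0") (simp_all add: poly_subst_def cst_def)

lemma perm_act_simps:
  "perm_act p (cst c) = cst c" "perm_act p (zz j) = zz (p j)" "perm_act p (zbar j) = zbar (p j)"
  "perm_act p (f + g) = perm_act p f + perm_act p g"
  "perm_act p (f * g) = perm_act p f * perm_act p (g :: 'n::finite zpoly)"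
  by (simp_all add: perm_act_def poly_subst_cst poly_subst_indet poly_subst_add poly_subst_mult)

lemma perm_act_zero: "perm_act p 0 = 0"
  by (simp add: perm_act_def poly_subst_zero)

lemma perm_act_one: "perm_act p 1 = 1"
  using poly_subst_cst[of _ 1] by (simp add: perm_act_def cst_simps)

lemma perm_act_uminus: "perm_act p (- f) = - perm_act p (f :: 'n::finite zpoly)"
  using perm_act_simps(4)[of p f "- f"] by (simp add: perm_act_zero eq_neg_iff_add_eq_0 add.commute)

lemma perm_act_sum: "perm_act p (sum h I) = (\<Sum>k\<in>I. perm_act p (h k))"
  by (simp add: perm_act_def poly_subst_sum)

lemma perm_act_power: "perm_act p (f ^ k) = perm_act p (f :: 'n::finite zpoly) ^ k"
  by (induction k) (simp_all add: perm_act_one perm_act_simps)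

lemma perm_act_bimonomial: "perm_act p (bimonomial \<alpha> j) = bimonomial \<alpha> (p j :: 'n::finite)"
  by (simp add: bimonomial_def perm_act_simps perm_act_power)

lemma perm_act_single:
  fixes m :: "'n::finite zvar \<Rightarrow>\<^sub>0 nat"
  shows "perm_act p (Poly_Mapping.single m c) =
    cst c * (\<Prod>j\<in>UNIV. bimonomial (Poly_Mapping.lookup m (Hol j), Poly_Mapping.lookup m (Anti j)) (p j))"
  unfolding perm_act_def poly_subst_single[OF finite_zvar] UNIV_zvar
  by (subst prod.union_disjoint)
     (auto simp: prod.reindex inj_on_def bimonomial_def prod.distrib)

lemma subalgebra_bisymmetric: "subalgebra bisymmetric"
  by unfold_locales (auto simp: bisymmetric_def perm_act_simps)

lemma bisymmetric_polarized_power_sum: "polarized_power_sum \<alpha> \<in> bisymmetric"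
  unfolding bisymmetric_def polarized_power_sum_def
  by (auto simp: perm_act_sum perm_act_bimonomial intro!: sum.reindex_bij_betw)

text \<open>Both sides are biderivations along the action, so it suffices to compare them on the variables,
where injectivity keeps distinct indices distinct.\<close>

lemma perm_act_poisson:
  fixes f g :: "'n::finite zpoly"
  assumes "inj p"
  shows "perm_act p (poisson f g) = poisson (perm_act p f) (perm_act p g)"
proof -
  have gens: "perm_act p (poisson (indet v) (indet w)) = poisson (perm_act p (indet v)) (perm_act p (indet w))"
    for v w :: "'n zvar"
    using assms
    by (cases v; cases w)
       (simp_all add: perm_act_simps poisson_gens perm_act_zero perm_act_uminus inj_eq)
  have right: "perm_act p (poisson (indet v) g) = poisson (perm_act p (indet v)) (perm_act p g)"
    for v and g :: "'n zpoly"
    by (induction g rule: zpoly_induct)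
       (simp_all add: gens perm_act_simps poisson_cst_right perm_act_zero poisson_add_right poisson_mult_right)
  show ?thesis
    by (induction f rule: zpoly_induct)
       (simp_all add: right perm_act_simps poisson_cst_left perm_act_zero poisson_add_left poisson_mult_left)
qed

lemma poisson_generated_subset_bisymmetric:
  assumes "G \<subseteq> bisymmetric"
  shows "poisson_generated G \<subseteq> (bisymmetric :: 'n::finite zpoly set)"
proof
  fix f assume "f \<in> poisson_generated G"
  then show "f \<in> bisymmetric"
    by induction (use assms in \<open>auto simp: bisymmetric_def perm_act_simps perm_act_poisson bij_is_inj\<close>)
qed

text \<open>Once the index set is listed as \<open>es\<close>, bijections \<open>p\<close> correspond to arrangements \<open>map p es\<close> of full
length. The witness, which does not depend on the coefficient, lists the exponents of the monomial
along \<open>es\<close>.\<close>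

lemma sum_perm_act_single:
  fixes m :: "'n::finite zvar \<Rightarrow>\<^sub>0 nat"
  obtains xs where "\<And>c. (\<Sum>p | bij p. perm_act p (Poly_Mapping.single m c)) = cst c * arrangement_sum xs"
proof -
  obtain es :: "'n list" where es: "set es = UNIV" "distinct es"
    using finite_distinct_list[of "UNIV :: 'n set"] by auto
  define \<mu> where "\<mu> j = (Poly_Mapping.lookup m (Hol j), Poly_Mapping.lookup m (Anti j))" for j
  have bij: "bij_betw (\<lambda>p :: 'n \<Rightarrow> 'n. map p es) {p. bij p} (arrangements (length es))"
  proof (rule bij_betw_imageI)
    show "inj_on (\<lambda>p :: 'n \<Rightarrow> 'n. map p es) {p. bij p}"
      using es by (auto simp: inj_on_def fun_eq_iff)
    show "(\<lambda>p :: 'n \<Rightarrow> 'n. map p es) ` {p. bij p} = arrangements (length es)"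
    proof (intro equalityI subsetI)
      fix js assume "js \<in> (\<lambda>p :: 'n \<Rightarrow> 'n. map p es) ` {p. bij p}"
      then show "js \<in> arrangements (length es)"
        using es by (auto simp: arrangements_def distinct_map dest: bij_is_inj)
    next
      fix js :: "'n list" assume js: "js \<in> arrangements (length es)"
      define p where "p = the \<circ> map_of (zip es js)"
      have map: "map p es = js"
        using js es unfolding p_def by (intro nth_equalityI)
          (auto simp: arrangements_def map_of_zip_nth)
      have "inj p"
        using js es map by (metis (no_types, lifting) arrangements_def distinct_map mem_Collect_eq)
      then have "bij p"
        by (simp add: bij_def finite_UNIV_inj_surj)
      then show "js \<in> (\<lambda>p :: 'n \<Rightarrow> 'n. map p es) ` {p. bij p}"
        using map by blast
    qed
  qed
  have "arrangement_sum (map \<mu> es) = (\<Sum>p :: 'n \<Rightarrow> 'n | bij p. arrangement_term (map \<mu> es) (map p es))"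
    using sum.reindex_bij_betw[OF bij, of "arrangement_term (map \<mu> es)"]
    by (simp add: arrangement_sum_def)
  moreover have "arrangement_term (map \<mu> es) (map p es) = (\<Prod>j\<in>UNIV. bimonomial (\<mu> j) (p j))"
    for p :: "'n \<Rightarrow> 'n"
    using prod.distinct_set_conv_list[OF es(2), of "\<lambda>j. bimonomial (\<mu> j) (p j)"]
    by (simp add: arrangement_term_def es(1) zip_map_map zip_same_conv_map comp_def)
  ultimately have "(\<Sum>p | bij p. perm_act p (Poly_Mapping.single m c)) = cst c * arrangement_sum (map \<mu> es)" for c
    by (simp add: perm_act_single sum_distrib_left flip: \<mu>_def)
  then show thesis
    by (rule that)
qed

text \<open>An invariant polynomial is its own average over the symmetric group, and averages of monomials are
scalar multiples of arrangement sums.\<close>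

lemma (in subalgebra) bisymmetric_subset:
  assumes "\<And>\<gamma>. polarized_power_sum \<gamma> \<in> A"
  shows "bisymmetric \<subseteq> A"
proof
  fix f :: "'n zpoly" assume f: "f \<in> bisymmetric"
  have "arrangement_sum xs \<in> A" for xs
    by (rule arrangement_sum_mem[where \<delta> = 0]) (simp_all add: assms)
  then have single: "(\<Sum>p | bij p. perm_act p (Poly_Mapping.single m c)) \<in> A" for m c
    by (metis cst_mem mult_mem sum_perm_act_single)
  have "(\<Sum>p | bij p. perm_act p f) =
      (\<Sum>p | bij p. perm_act p (\<Sum>m\<in>Poly_Mapping.keys f. Poly_Mapping.single m (Poly_Mapping.lookup f m)))"
    by (simp only: single_sum_expand)
  also have "\<dots> = (\<Sum>m\<in>Poly_Mapping.keys f. \<Sum>p | bij p. perm_act p (Poly_Mapping.single m (Poly_Mapping.lookup f m)))"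
    unfolding perm_act_sum by (rule sum.swap)
  also have "\<dots> \<in> A"
    by (intro sum_mem single)
  finally have "of_nat (card {p :: 'n \<Rightarrow> 'n. bij p}) * f \<in> A"
    using f by (simp add: bisymmetric_def)
  moreover have "card {p :: 'n \<Rightarrow> 'n. bij p} \<noteq> 0"
    using bij_id by (auto simp: card_eq_0_iff)
  ultimately show "f \<in> A"
    by (rule of_nat_mult_cancel)
qed


section \<open>Brackets\<close>

text \<open>The coordinate form of the bracket is built from the Euler operators \<open>z\<^sub>j \<partial>/\<partial>z\<^sub>j\<close> and their conjugates,
for which monomials are eigenvectors. This gives the bracket of two polarized power sums its simple
form.\<close>

lemma euler_power:
  "indet v * pdv v (indet w ^ k) = (if v = w then of_nat k * indet w ^ k else 0)"
  by (induction k)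
     (auto simp: pdv_mult pdv_indet pdv_cst[of _ 1, unfolded cst_simps] algebra_simps mult.left_commute[of _ "indet w"])

lemma euler_bimonomial:
  "zz j * pdv (Hol j) (bimonomial \<alpha> k) = (if j = k then of_nat (fst \<alpha>) * bimonomial \<alpha> k else 0)"
  "zbar j * pdv (Anti j) (bimonomial \<alpha> k) = (if j = k then of_nat (snd \<alpha>) * bimonomial \<alpha> k else 0)"
proof -
  have leibniz: "indet v * pdv v (f * g) = f * (indet v * pdv v g) + indet v * pdv v f * g"
    for v and f g :: "'a zpoly"
    by (simp add: pdv_mult algebra_simps)
  show
    "zz j * pdv (Hol j) (bimonomial \<alpha> k) = (if j = k then of_nat (fst \<alpha>) * bimonomial \<alpha> k else 0)"
    "zbar j * pdv (Anti j) (bimonomial \<alpha> k) = (if j = k then of_nat (snd \<alpha>) * bimonomial \<alpha> k else 0)"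
    by (auto simp: bimonomial_def leibniz euler_power algebra_simps)
qed

lemma poisson_polarized_power_sum:
  "poisson (polarized_power_sum (a, b)) (polarized_power_sum (c, d)) =
    (of_nat (a * d) - of_nat (b * c)) * (polarized_power_sum (a + c, b + d) :: 'n::finite zpoly)"
proof -
  let ?p = "polarized_power_sum :: _ \<Rightarrow> 'n zpoly"
  have euler: "zz j * pdv (Hol j) (?p \<alpha>) = of_nat (fst \<alpha>) * bimonomial \<alpha> j"
    "zbar j * pdv (Anti j) (?p \<alpha>) = of_nat (snd \<alpha>) * bimonomial \<alpha> j" for \<alpha> j
    by (simp_all add: polarized_power_sum_def pdv_sum sum_distrib_left euler_bimonomial)
  have "poisson (?p (a, b)) (?p (c, d)) = (\<Sum>j\<in>UNIV.
      (zz j * pdv (Hol j) (?p (a, b))) * (zbar j * pdv (Anti j) (?p (c, d)))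
      - (zbar j * pdv (Anti j) (?p (a, b))) * (zz j * pdv (Hol j) (?p (c, d))))"
    unfolding poisson_eq_coord coord_bracket_def
    by (rule sum.cong[OF refl]) (simp add: algebra_simps)
  also have "\<dots> = (\<Sum>j\<in>UNIV. (of_nat (a * d) - of_nat (b * c)) * bimonomial ((a, b) + (c, d)) j)"
    unfolding euler bimonomial_add by (rule sum.cong[OF refl]) (simp add: algebra_simps)
  finally show ?thesis
    by (simp add: polarized_power_sum_def sum_distrib_left)
qed

lemma subalgebra_poisson_generated: "subalgebra (poisson_generated G)"
  by unfold_locales (auto intro: poisson_generated.intros)

text \<open>If \<open>a\<close> or \<open>b\<close> vanishes, then \<open>p(a, b)\<close> is a pure power sum and comes from the algebra structure alone;
otherwise the bracket \<open>{p(a, 0), p(0, b)} = a b p(a, b)\<close> produces it.\<close>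

lemma bisymmetric_subset_poisson_generated:
  assumes "elem_sym ` {1..CARD('n)} \<union> elem_sym_bar ` {1..CARD('n)} \<subseteq> poisson_generated G"
  shows "(bisymmetric :: 'n::finite zpoly set) \<subseteq> poisson_generated G"
proof -
  interpret subalgebra "poisson_generated G"
    by (rule subalgebra_poisson_generated)
  have it: "((+) (1, 0) ^^ k) 0 = (k, 0 :: nat)" "((+) (0, 1) ^^ k) 0 = (0 :: nat, k)" for k
    by (induction k) (simp_all add: zero_prod_def)
  have pure: "polarized_power_sum (k, 0) \<in> poisson_generated G"
    "polarized_power_sum (0, k) \<in> poisson_generated G" for k
    using polarized_power_sum_multiple_mem[of "(1, 0)" k] polarized_power_sum_multiple_mem[of "(0, 1)" k]
      replicate_unit_mem_if_elem_sym[OF assms]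
    unfolding it by blast+
  have "polarized_power_sum (a, b) \<in> poisson_generated G" for a b
  proof (cases "a * b = 0")
    case True
    then show ?thesis using pure by auto
  next
    case False
    have "of_nat (a * b) * polarized_power_sum (a, b) \<in> poisson_generated G"
      using poisson_generated.bracket[OF pure, of a b]
      by (simp add: poisson_polarized_power_sum)
    then show ?thesis
      using False by (rule of_nat_mult_cancel)
  qed
  then show ?thesis
    by (intro bisymmetric_subset) auto
qed

text \<open>A bracket of polynomials in iterated brackets is expanded by the Leibniz rule, first in the left
argument and then in the right one, into products of iterated brackets.\<close>

lemma alg_generated_iterated_brackets:
  "alg_generated (iterated_brackets G) = (poisson_generated G :: 'n::finite zpoly set)"
proof
  have iter: "f \<in> poisson_generated G" if "f \<in> iterated_brackets G" for f
    using that by induction (simp_all add: poisson_generated.intros)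
  have "f \<in> poisson_generated G" if "f \<in> alg_generated (iterated_brackets G)" for f
    using that by induction (simp_all add: poisson_generated.intros iter)
  then show "alg_generated (iterated_brackets G) \<subseteq> poisson_generated G" ..
next
  let ?A = "alg_generated (iterated_brackets G)"
  have zero: "0 \<in> ?A"
    using alg_generated.const[of 0] by (simp add: cst_simps)
  have left: "poisson f g \<in> ?A" if "f \<in> ?A" "g \<in> iterated_brackets G" for f g
    using that
    by induction
       (simp_all add: poisson_cst_left poisson_add_left poisson_mult_left zero
         alg_generated.intros iterated_brackets.bracket)
  have bracket: "poisson f g \<in> ?A" if "g \<in> ?A" "f \<in> ?A" for f g
    using that
    by induction
       (simp_all add: poisson_cst_right poisson_add_right poisson_mult_right zero
         alg_generated.intros left)
  have "f \<in> ?A" if "f \<in> poisson_generated G" for f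
    using that
    by induction (simp_all add: alg_generated.intros iterated_brackets.gen bracket)
  then show "poisson_generated G \<subseteq> ?A" ..
qed

theorem corollary3p4p4:
  shows "poisson_generated (power_sum ` {1..CARD('n)} \<union> power_sum_bar ` {1..CARD('n)})
           = (bisymmetric :: 'n::finite zpoly set)
       \<and> alg_generated (iterated_brackets (power_sum ` {1..CARD('n)} \<union> power_sum_bar ` {1..CARD('n)}))
           = (bisymmetric :: 'n zpoly set)
       \<and> alg_generated (iterated_brackets (elem_sym ` {1..CARD('n)} \<union> elem_sym_bar ` {1..CARD('n)}))
           = (bisymmetric :: 'n zpoly set)"
proof -
  let ?P = "power_sum ` {1..CARD('n)} \<union> power_sum_bar ` {1..CARD('n)} :: 'n zpoly set"
  let ?E = "elem_sym ` {1..CARD('n)} \<union> elem_sym_bar ` {1..CARD('n)} :: 'n zpoly set"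
  have "?E \<subseteq> poisson_generated ?P"
    by (rule subalgebra.elem_sym_mem_if_power_sums[OF subalgebra_poisson_generated])
       (auto intro: poisson_generated.gen)
  moreover have P_bisym: "?P \<subseteq> bisymmetric"
    by (auto simp: power_sum_polarized bisymmetric_polarized_power_sum)
  ultimately have P: "poisson_generated ?P = bisymmetric"
    by (intro equalityI poisson_generated_subset_bisymmetric bisymmetric_subset_poisson_generated)
  have "?E \<subseteq> poisson_generated ?E"
    by (auto intro: poisson_generated.gen)
  moreover have "?E \<subseteq> bisymmetric"
    using P_bisym
    by (rule subalgebra.elem_sym_mem_if_power_sums[OF subalgebra_bisymmetric])
  ultimately have "poisson_generated ?E = bisymmetric"
    by (intro equalityI poisson_generated_subset_bisymmetric bisymmetric_subset_poisson_generated)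
  with P show ?thesis
    by (simp add: alg_generated_iterated_brackets)
qed

end
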